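(* Let $A\in\mathbb{R}^{m\times n}$ be a nonzero matrix, let $b\in\mathbb{R}^{m}$, and let $x_{\star}=A^{\dagger}b$ be the minimum Euclidean norm least squares solution of $\min_{x\in\mathbb{R}^n}\|b-Ax\|_2^2$. Let $A=U\Sigma V^T$ be a singular value decomposition with left singular vectors $u_1,\dots,u_m$ and singular values $\sigma_1(A)\ge\sigma_2(A)\ge\cdots$. Let $z_k$ be the $k$th approximation generated by the randomized extended Gauss--Seidel (REGS) method with (deterministic) initial vectors $x_0\in\mathbb{R}^n$ and $z_0\in\mathcal{R}(A^T)$. Then for every $k\ge 0$ and every $\ell\in\{1,\dots,\min\{m,n\}\}$, $$\mathbb{E}\big[\langle Az_k-Ax_{\star},u_\ell\rangle\big]=\Big(1-\frac{\sigma_\ell^2(A)}{\|A\|_F^2}\Big)^k\langle Az_0-Ax_{\star},u_\ell\rangle+\frac{k}{\|A\|_F^2}\Big(1-\frac{\sigma_\ell^2(A)}{\|A\|_F^2}\Big)^k\langle AA^T(Ax_0-Ax_{\star}),u_\ell\rangle .$$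
   Context: Notation: $A^{(i)}$ is the $i$th row of $A$ (a row vector), $A_{(j)}$ is the $j$th column of $A$, $e_{(j)}$ is the $j$th column of the $n\times n$ identity matrix, $\|A\|_F$ is the Frobenius norm, $\mathcal{R}(\cdot)$ is the column space, $A^{\dagger}$ is the Moore--Penrose pseudoinverse, $\langle\cdot,\cdot\rangle$ is the Euclidean inner product, $\sigma_i(A)$ is the $i$th singular value of $A$. Singular value decomposition: $A=U\Sigma V^T$ with $U=[u_1,\dots,u_m]\in\mathbb{R}^{m\times m}$ and $V=[v_1,\dots,v_n]\in\mathbb{R}^{n\times n}$ orthogonal, and $\Sigma\in\mathbb{R}^{m\times n}$ diagonal with diagonal entries $\sigma_1(A)\ge\sigma_2(A)\ge\cdots$ in nonincreasing order; $u_i$, $v_i$ are the left and right singular vectors. REGS method: starting from $x_0\in\mathbb{R}^n$ and $z_0\in\mathcal{R}(A^T)$, for $k=1,2,\dots$: select $j\in\{1,\dots,n\}$ with probability $\|A_{(j)}\|_2^2/\|A\|_F^2$ and set $$x_k=x_{k-1}-\frac{A_{(j)}^T(Ax_{k-1}-b)}{\|A_{(j)}\|_2^2}\,e_{(j)};$$ then select $i\in\{1,\dots,m\}$ with probability $\|A^{(i)}\|_2^2/\|A\|_F^2$ and set $$z_k=z_{k-1}-\frac{A^{(i)}(z_{k-1}-x_k)}{\|A^{(i)}\|_2^2}\,(A^{(i)})^T .$$ All selections are mutually independent, and $\mathbb{E}$ is the expectation over all of them. *)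

theory Defs
  imports "HOL-Probability.Probability"
begin

(* The norm of a matrix of type real^'n^'m is the Euclidean norm of its rows' Euclidean norms,
   so "norm A" is the Frobenius norm of A. *)

lemma norm_sq_eq_sum_rows:
  fixes A :: "real^'n^'m"
  shows "(norm A)\<^sup>2 = (\<Sum>i\<in>UNIV. (norm (row i A))\<^sup>2)"
  by (simp add: norm_vec_def L2_set_def sum_nonneg row_def)

lemma norm_sq_eq_sum_columns:
  fixes A :: "real^'n^'m"
  shows "(norm A)\<^sup>2 = (\<Sum>j\<in>UNIV. (norm (column j A))\<^sup>2)"
proof -
  have "(norm A)\<^sup>2 = (\<Sum>i\<in>UNIV. \<Sum>j\<in>UNIV. (A $ i $ j)\<^sup>2)"
    by (simp add: norm_vec_def L2_set_def sum_nonneg)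
  also have "\<dots> = (\<Sum>j\<in>UNIV. \<Sum>i\<in>UNIV. (A $ i $ j)\<^sup>2)"
    by (rule sum.swap)
  also have "\<dots> = (\<Sum>j\<in>UNIV. (norm (column j A))\<^sup>2)"
    by (simp add: norm_vec_def L2_set_def sum_nonneg column_def)
  finally show ?thesis .
qed


definition is_pseudoinverse :: "real^'n^'m \<Rightarrow> real^'m^'n \<Rightarrow> bool" where
  "is_pseudoinverse A X \<longleftrightarrow>
     A ** X ** A = A \<and> X ** A ** X = X \<and>
     transpose (A ** X) = A ** X \<and> transpose (X ** A) = X ** A"

lemma is_pseudoinverse_unique:
  assumes X: "is_pseudoinverse A X" and Y: "is_pseudoinverse A Y"
  shows "X = Y"
proof -
  have "A ** X = (A ** Y ** A) ** X"
    using Y by (simp add: is_pseudoinverse_def)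
  also have "\<dots> = (A ** Y) ** (A ** X)"
    by (simp only: matrix_mul_assoc)
  also have "\<dots> = transpose (A ** Y) ** transpose (A ** X)"
    using X Y by (simp add: is_pseudoinverse_def)
  also have "\<dots> = transpose ((A ** X ** A) ** Y)"
    by (simp add: matrix_transpose_mul matrix_mul_assoc)
  also have "\<dots> = A ** Y"
    using X Y by (simp add: is_pseudoinverse_def)
  finally have AX: "A ** X = A ** Y" .
  have "X ** A = X ** (A ** Y ** A)"
    using Y by (simp add: is_pseudoinverse_def)
  also have "\<dots> = (X ** A) ** (Y ** A)"
    by (simp only: matrix_mul_assoc)
  also have "\<dots> = transpose (X ** A) ** transpose (Y ** A)"
    using X Y by (simp add: is_pseudoinverse_def)
  also have "\<dots> = transpose (Y ** (A ** X ** A))"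
    by (simp add: matrix_transpose_mul matrix_mul_assoc)
  also have "\<dots> = Y ** A"
    using X Y by (simp add: is_pseudoinverse_def)
  finally have XA: "X ** A = Y ** A" .
  have "X = X ** A ** X"
    using X by (simp add: is_pseudoinverse_def)
  also have "\<dots> = Y ** A ** Y"
    using AX XA by (metis matrix_mul_assoc)
  also have "\<dots> = Y"
    using Y by (simp add: is_pseudoinverse_def)
  finally show ?thesis .
qed

definition pseudoinverse :: "real^'n^'m \<Rightarrow> real^'m^'n" where
  "pseudoinverse A = (THE X. is_pseudoinverse A X)"


(* The index types 'm and 'n carry no order, so "the l-th column" and "the l-th diagonal entry"
   are taken along enumerations r of the m row indices and c of the n column indices:
   u_l = column (r l) U, v_l = column (c l) V and sigma_l(A) = S $ r l $ c l. *)

definition is_svd ::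
  "(nat \<Rightarrow> 'm) \<Rightarrow> (nat \<Rightarrow> 'n) \<Rightarrow> real^'n^'m \<Rightarrow> real^'m^'m \<Rightarrow> real^'n^'m \<Rightarrow> real^'n^'n \<Rightarrow> bool"
where
  "is_svd r c A U S V \<longleftrightarrow>
     bij_betw r {1..CARD('m)} UNIV \<and> bij_betw c {1..CARD('n)} UNIV \<and>
     orthogonal_matrix U \<and> orthogonal_matrix V \<and>
     (\<forall>i\<in>{1..CARD('m)}. \<forall>j\<in>{1..CARD('n)}. i \<noteq> j \<longrightarrow> S $ r i $ c j = 0) \<and>
     (\<forall>i\<in>{1..min CARD('m) CARD('n)}. 0 \<le> S $ r i $ c i) \<and>
     (\<forall>i\<in>{1..min CARD('m) CARD('n)}. \<forall>j\<in>{1..min CARD('m) CARD('n)}.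
        i \<le> j \<longrightarrow> S $ r j $ c j \<le> S $ r i $ c i) \<and>
     A = U ** S ** transpose V"


(* Meaningful only for A \<noteq> 0; see pmf_column_pmf and pmf_row_pmf. *)

definition column_pmf :: "real^'n^'m \<Rightarrow> 'n pmf" where
  "column_pmf A = embed_pmf (\<lambda>j. (norm (column j A))\<^sup>2 / (norm A)\<^sup>2)"

definition row_pmf :: "real^'n^'m \<Rightarrow> 'm pmf" where
  "row_pmf A = embed_pmf (\<lambda>i. (norm (row i A))\<^sup>2 / (norm A)\<^sup>2)"

lemma pmf_column_pmf:
  assumes "A \<noteq> 0"
  shows "pmf (column_pmf A) j = (norm (column j A))\<^sup>2 / (norm A)\<^sup>2"
  unfolding column_pmf_def
proof (rule pmf_embed_pmf)
  have "(\<Sum>j\<in>UNIV. (norm (column j A))\<^sup>2 / (norm A)\<^sup>2) = 1"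
    using assms by (simp flip: sum_divide_distrib norm_sq_eq_sum_columns)
  then show "(\<integral>\<^sup>+j. ennreal ((norm (column j A))\<^sup>2 / (norm A)\<^sup>2) \<partial>count_space UNIV) = 1"
    by (simp add: nn_integral_count_space_finite sum_ennreal)
qed simp

lemma pmf_row_pmf:
  assumes "A \<noteq> 0"
  shows "pmf (row_pmf A) i = (norm (row i A))\<^sup>2 / (norm A)\<^sup>2"
  unfolding row_pmf_def
proof (rule pmf_embed_pmf)
  have "(\<Sum>i\<in>UNIV. (norm (row i A))\<^sup>2 / (norm A)\<^sup>2) = 1"
    using assms by (simp flip: sum_divide_distrib norm_sq_eq_sum_rows)
  then show "(\<integral>\<^sup>+i. ennreal ((norm (row i A))\<^sup>2 / (norm A)\<^sup>2) \<partial>count_space UNIV) = 1"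
    by (simp add: nn_integral_count_space_finite sum_ennreal)
qed simp

definition x_update :: "real^'n^'m \<Rightarrow> real^'m \<Rightarrow> 'n \<Rightarrow> real^'n \<Rightarrow> real^'n" where
  "x_update A b j x =
     x - ((column j A \<bullet> (A *v x - b)) / (norm (column j A))\<^sup>2) *\<^sub>R axis j 1"

definition z_update :: "real^'n^'m \<Rightarrow> 'm \<Rightarrow> real^'n \<Rightarrow> real^'n \<Rightarrow> real^'n" where
  "z_update A i x z = z - ((row i A \<bullet> (z - x)) / (norm (row i A))\<^sup>2) *\<^sub>R row i A"

(* Joint law of (x_k, z_k). Each step draws from fixed distributions that do not depend on
   the state, so all selections are mutually independent. *)

primrec regs ::
  "real^'n^'m \<Rightarrow> real^'m \<Rightarrow> real^'n \<Rightarrow> real^'n \<Rightarrow> nat \<Rightarrow> ((real^'n) \<times> (real^'n)) pmf"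
where
  "regs A b x0 z0 0 = return_pmf (x0, z0)"
| "regs A b x0 z0 (Suc k) =
     do {
       (x, z) \<leftarrow> regs A b x0 z0 k;
       j \<leftarrow> column_pmf A;
       let x' = x_update A b j x;
       i \<leftarrow> row_pmf A;
       return_pmf (x', z_update A i x' z)
     }"

end

theory Submission
  imports Defs
begin

text \<open>
  Write \<open>\<sigma>\<close> for the singular value with left and right singular vectors \<open>u\<close> and \<open>v\<close>. Moving \<open>A\<close>
  across the inner product turns \<open>\<langle>A y, u\<rangle>\<close> into \<open>\<sigma> \<langle>y, v\<rangle>\<close>, so it suffices to follow the errors
  \<open>x - x\<^sub>s\<close> and \<open>z - x\<^sub>s\<close> in the direction \<open>v\<close>, which is an eigenvector of the Gram matrix
  \<open>A\<^sup>T A\<close> with eigenvalue \<open>s = \<sigma>\<^sup>2\<close>.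

  The sampling probabilities cancel the denominators of the updates, so that on average
  a column step is the gradient step \<open>x \<mapsto> x - A\<^sup>T (A x - b) / \<parallel>A\<parallel>\<^sup>2\<close> and a row step is
  \<open>z \<mapsto> z - A\<^sup>T A (z - x) / \<parallel>A\<parallel>\<^sup>2\<close>. As \<open>x\<^sub>s\<close> solves the normal equations, the right-hand side
  \<open>A\<^sup>T b\<close> equals \<open>A\<^sup>T A x\<^sub>s\<close>, and both averaged steps act on the \<open>v\<close>-components by scalars. With
  \<open>q = 1 - s / \<parallel>A\<parallel>\<^sup>2\<close> and expected components \<open>\<alpha>\<^sub>k\<close> of \<open>x\<^sub>k - x\<^sub>s\<close> and \<open>\<beta>\<^sub>k\<close> of \<open>z\<^sub>k - x\<^sub>s\<close>,
  the recursion is \<open>\<alpha>\<^sub>k = q \<alpha>\<^sub>k\<^sub>-\<^sub>1\<close> and \<open>\<beta>\<^sub>k = q \<beta>\<^sub>k\<^sub>-\<^sub>1 + (s / \<parallel>A\<parallel>\<^sup>2) \<alpha>\<^sub>k\<close>. The forcing term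
  decays at the same rate \<open>q\<close> as the homogeneous solution; this resonance produces the factor
  \<open>k\<close> in \<open>\<beta>\<^sub>k = q\<^sup>k (\<beta>\<^sub>0 + k (s / \<parallel>A\<parallel>\<^sup>2) \<alpha>\<^sub>0)\<close>.

  That \<open>x\<^sub>s = A\<^sup>\<dagger> b\<close> solves the normal equations follows from the Penrose conditions. Since the
  pseudoinverse is a definite description, one has to be exhibited: the singular value
  decomposition supplies \<open>V S\<^sup>\<dagger> U\<^sup>T\<close>, where \<open>S\<^sup>\<dagger>\<close> inverts the entries of \<open>S\<^sup>T\<close> one by one.
\<close>

section \<open>The pseudoinverse and the normal equations\<close>

text \<open>
  To invert \<open>S\<close> entry by entry, only this consequence of diagonality matters. Unlike diagonality it
  does not mention the enumerations of the indices, and it passes from \<open>S\<close> to the transposed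
  matrix of inverses.
\<close>

definition at_most_one_entry_per_line :: "real^'n^'m \<Rightarrow> bool" where
  "at_most_one_entry_per_line S \<longleftrightarrow>
     (\<forall>i j j'. S $ i $ j \<noteq> 0 \<longrightarrow> S $ i $ j' \<noteq> 0 \<longrightarrow> j = j') \<and>
     (\<forall>i i' j. S $ i $ j \<noteq> 0 \<longrightarrow> S $ i' $ j \<noteq> 0 \<longrightarrow> i = i')"

text \<open>
  The convention \<open>inverse 0 = 0\<close> keeps the zero entries, as in the pseudoinverse of a diagonal matrix.
\<close>

definition entrywise_inverse_transpose :: "real^'n^'m \<Rightarrow> real^'m^'n" where
  "entrywise_inverse_transpose S = (\<chi> j i. inverse (S $ i $ j))"

lemma entrywise_inverse_transpose_involutive:
  "entrywise_inverse_transpose (entrywise_inverse_transpose S) = S"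
  by (simp add: entrywise_inverse_transpose_def vec_eq_iff)

lemma at_most_one_entry_per_line_inverse_transpose:
  "at_most_one_entry_per_line S \<Longrightarrow> at_most_one_entry_per_line (entrywise_inverse_transpose S)"
  unfolding at_most_one_entry_per_line_def entrywise_inverse_transpose_def
  by (simp only: vec_lambda_beta inverse_nonzero_iff_nonzero) blast

text \<open>
  The product is the coordinate projection onto the nonzero rows: in a nonzero row the only
  surviving summand is an entry times its own inverse, and distinct rows share no column.
\<close>

lemma mult_entrywise_inverse_transpose:
  assumes "at_most_one_entry_per_line S"
  shows "(S ** entrywise_inverse_transpose S) $ i $ k = (if i = k \<and> (\<exists>j. S $ i $ j \<noteq> 0) then 1 else 0)"
proof (cases "i = k \<and> (\<exists>j. S $ i $ j \<noteq> 0)")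
  case True
  then obtain j where j: "S $ i $ j \<noteq> 0" and ik: "k = i" by blast
  have "S $ i $ j' * inverse (S $ i $ j') = (if j' = j then 1 else 0)" for j'
  proof (cases "S $ i $ j' = 0")
    case True
    with j show ?thesis by auto
  next
    case False
    with assms j have "j' = j"
      unfolding at_most_one_entry_per_line_def by blast
    with j show ?thesis by simp
  qed
  then show ?thesis
    using j by (auto simp: matrix_matrix_mult_def entrywise_inverse_transpose_def ik)
next
  case False
  then have "S $ i $ j * inverse (S $ k $ j) = 0" for j
    using assms unfolding at_most_one_entry_per_line_def mult_eq_0_iff inverse_nonzero_iff_nonzero
    by metis
  then have "(\<Sum>j\<in>UNIV. S $ i $ j * inverse (S $ k $ j)) = 0"
    by (rule sum.neutral[OF ballI])
  then show ?thesis
    using False by (simp add: matrix_matrix_mult_def entrywise_inverse_transpose_def)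
qed

text \<open>
  Two of the Penrose conditions concern the coordinate projection above; the other two are the
  same conditions with the roles of \<open>S\<close> and its inverse pattern exchanged.
\<close>

lemma is_pseudoinverse_entrywise_inverse_transpose:
  assumes S: "at_most_one_entry_per_line S"
  shows "is_pseudoinverse S (entrywise_inverse_transpose S)"
proof -
  have cancel: "T ** entrywise_inverse_transpose T ** T = T"
    and sym: "transpose (T ** entrywise_inverse_transpose T) = T ** entrywise_inverse_transpose T"
    if T: "at_most_one_entry_per_line T" for T :: "real^'p^'q"
  proof -
    have "(T ** entrywise_inverse_transpose T ** T) $ i $ k = T $ i $ k" for i k
    proof -
      have "(T ** entrywise_inverse_transpose T ** T) $ i $ k =
          (\<Sum>j\<in>UNIV. (T ** entrywise_inverse_transpose T) $ i $ j * T $ j $ k)"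
        by (simp add: matrix_matrix_mult_def[of _ T])
      also have "\<dots> = (\<Sum>j\<in>UNIV. if j = i then (if \<exists>j'. T $ i $ j' \<noteq> 0 then 1 else 0) * T $ i $ k else 0)"
        by (rule sum.cong) (simp_all add: mult_entrywise_inverse_transpose[OF T])
      finally show ?thesis by auto
    qed
    then show "T ** entrywise_inverse_transpose T ** T = T"
      by (simp add: vec_eq_iff)
    show "transpose (T ** entrywise_inverse_transpose T) = T ** entrywise_inverse_transpose T"
      by (auto simp: vec_eq_iff transpose_def mult_entrywise_inverse_transpose[OF T])
  qed
  have S': "at_most_one_entry_per_line (entrywise_inverse_transpose S)"
    using S by (rule at_most_one_entry_per_line_inverse_transpose)
  show ?thesis
    unfolding is_pseudoinverse_def
    using cancel[OF S] sym[OF S] cancel[OF S'] sym[OF S']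
    by (simp add: entrywise_inverse_transpose_involutive)
qed

text \<open>
  In all products of the Penrose conditions the inner orthogonal factors cancel, which leaves the
  conditions for \<open>S\<close> and \<open>X\<close> between orthogonal factors.
\<close>

lemma is_pseudoinverse_orthogonal_conjugate:
  fixes S :: "real^'n^'m"
  assumes X: "is_pseudoinverse S X" and U: "orthogonal_matrix U" and V: "orthogonal_matrix V"
  shows "is_pseudoinverse (U ** S ** transpose V) (V ** X ** transpose U)"
proof -
  have conj: "(P ** T ** transpose Q) ** (Q ** Y ** transpose R) = P ** (T ** Y) ** transpose R"
    if "orthogonal_matrix Q"
    for P :: "real^'p^'p" and T :: "real^'q^'p" and Q :: "real^'q^'q" and Y :: "real^'s^'q"
      and R :: "real^'s^'s"
  proof -
    have "(P ** T ** transpose Q) ** (Q ** Y ** transpose R)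
        = P ** T ** (transpose Q ** Q) ** Y ** transpose R"
      by (simp only: matrix_mul_assoc)
    also have "transpose Q ** Q = mat 1"
      using that by (simp add: orthogonal_matrix)
    finally show ?thesis
      by (simp only: matrix_mul_assoc matrix_mul_rid)
  qed
  have symm: "transpose (P ** T ** transpose P) = P ** transpose T ** transpose P"
    for P T :: "real^'p^'p"
    by (simp add: matrix_transpose_mul matrix_mul_assoc)
  show ?thesis
    using X by (simp add: is_pseudoinverse_def conj[OF U] conj[OF V] symm)
qed

lemma is_svd_at_most_one_entry_per_line:
  fixes A :: "real^'n^'m"
  assumes "is_svd r c A U S V"
  shows "at_most_one_entry_per_line S"
proof -
  have r: "bij_betw r {1..CARD('m)} UNIV" and c: "bij_betw c {1..CARD('n)} UNIV"
    and off: "\<And>i j. i \<in> {1..CARD('m)} \<Longrightarrow> j \<in> {1..CARD('n)} \<Longrightarrow> i \<noteq> j \<Longrightarrow> S $ r i $ c j = 0"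
    using assms unfolding is_svd_def by auto
  have entry: "\<exists>k. i = r k \<and> j = c k \<and> k \<in> {1..CARD('m)} \<and> k \<in> {1..CARD('n)}"
    if "S $ i $ j \<noteq> 0" for i j
  proof -
    obtain p q where "p \<in> {1..CARD('m)}" "q \<in> {1..CARD('n)}" "i = r p" "j = c q"
      using r c unfolding bij_betw_def by (metis UNIV_I imageE)
    moreover from this have "p = q"
      using off that by blast
    ultimately show ?thesis by blast
  qed
  have "inj_on r {1..CARD('m)}" "inj_on c {1..CARD('n)}"
    using r c by (auto simp: bij_betw_def)
  then show ?thesis
    unfolding at_most_one_entry_per_line_def by (intro conjI allI impI; metis entry inj_onD)
qed

lemma is_pseudoinverse_pseudoinverse_if_svd:
  assumes "is_svd r c A U S V"
  shows "is_pseudoinverse A (pseudoinverse A)"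
proof -
  have X: "is_pseudoinverse A (V ** entrywise_inverse_transpose S ** transpose U)"
    using is_pseudoinverse_orthogonal_conjugate is_pseudoinverse_entrywise_inverse_transpose
      is_svd_at_most_one_entry_per_line[OF assms] assms
    unfolding is_svd_def by metis
  show ?thesis
    unfolding pseudoinverse_def
    by (rule theI[where P = "is_pseudoinverse A", OF X]) (rule is_pseudoinverse_unique[OF _ X])
qed

text \<open>
  The symmetry of \<open>A X\<close> turns \<open>A\<^sup>T A X\<close> into \<open>(A X A)\<^sup>T = A\<^sup>T\<close>.
\<close>

lemma is_pseudoinverse_normal_equations:
  assumes "is_pseudoinverse A X"
  shows "transpose A *v (A *v (X *v b)) = transpose A *v b"
proof -
  have "transpose A ** (A ** X) = transpose A ** transpose (A ** X)"
    using assms by (simp add: is_pseudoinverse_def)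
  also have "\<dots> = transpose (A ** X ** A)"
    by (simp add: matrix_transpose_mul)
  also have "\<dots> = transpose A"
    using assms by (simp add: is_pseudoinverse_def)
  finally show ?thesis
    by (simp add: matrix_vector_mul_assoc matrix_mul_assoc)
qed

section \<open>Singular vectors\<close>

lemma orthogonal_matrix_transpose_column:
  fixes Q :: "real^'n^'n"
  assumes "orthogonal_matrix Q"
  shows "transpose Q *v column j Q = axis j 1"
proof -
  have "transpose Q *v column j Q = transpose Q *v (Q *v axis j 1)"
    by (simp only: matrix_vector_mult_basis)
  also have "\<dots> = (transpose Q ** Q) *v axis j 1"
    by (rule matrix_vector_mul_assoc)
  also have "transpose Q ** Q = mat 1"
    using assms by (simp add: orthogonal_matrix)
  finally show ?thesis by simp
qed

text \<open>
  In the orthonormal bases of singular vectors \<open>A\<close> acts as \<open>S\<close>, and diagonality says that \<open>S\<close> and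
  \<open>S\<^sup>T\<close> exchange the corresponding coordinate vectors up to the factor \<open>\<sigma>\<close>.
\<close>

lemma is_svd_singular_vectors:
  fixes A :: "real^'n^'m"
  assumes svd: "is_svd r c A U S V" and l: "l \<in> {1..min CARD('m) CARD('n)}"
  shows "A *v column (c l) V = (S $ r l $ c l) *\<^sub>R column (r l) U"
    and "transpose A *v column (r l) U = (S $ r l $ c l) *\<^sub>R column (c l) V"
proof -
  have U: "orthogonal_matrix U" and V: "orthogonal_matrix V" and A: "A = U ** S ** transpose V"
    and r: "bij_betw r {1..CARD('m)} UNIV" and c: "bij_betw c {1..CARD('n)} UNIV"
    and off: "\<And>i j. i \<in> {1..CARD('m)} \<Longrightarrow> j \<in> {1..CARD('n)} \<Longrightarrow> i \<noteq> j \<Longrightarrow> S $ r i $ c j = 0"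
    using svd unfolding is_svd_def by auto
  define \<sigma> where "\<sigma> = S $ r l $ c l"
  have "S $ i $ c l = (if i = r l then \<sigma> else 0)" for i
  proof -
    obtain p where "p \<in> {1..CARD('m)}" "i = r p"
      using r unfolding bij_betw_def by (metis UNIV_I imageE)
    then have "i = r l \<or> S $ i $ c l = 0"
      using off[of p l] l by (cases "p = l") simp_all
    then show ?thesis by (auto simp: \<sigma>_def)
  qed
  then have Sc: "S *v axis (c l) 1 = \<sigma> *\<^sub>R axis (r l) 1"
    unfolding matrix_vector_mult_basis by (simp add: vec_eq_iff column_def axis_def)
  have "S $ r l $ j = (if j = c l then \<sigma> else 0)" for j
  proof -
    obtain q where "q \<in> {1..CARD('n)}" "j = c q"
      using c unfolding bij_betw_def by (metis UNIV_I imageE)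
    then have "j = c l \<or> S $ r l $ j = 0"
      using off[of l q] l by (cases "q = l") simp_all
    then show ?thesis by (auto simp: \<sigma>_def)
  qed
  then have Sr: "transpose S *v axis (r l) 1 = \<sigma> *\<^sub>R axis (c l) 1"
    unfolding matrix_vector_mult_basis
    by (simp add: vec_eq_iff column_def axis_def transpose_def)
  have "A *v column (c l) V = U *v (S *v (transpose V *v column (c l) V))"
    by (simp only: A matrix_vector_mul_assoc matrix_mul_assoc)
  also have "\<dots> = \<sigma> *\<^sub>R column (r l) U"
    unfolding orthogonal_matrix_transpose_column[OF V] Sc
    by (simp only: matrix_vector_mult_scaleR matrix_vector_mult_basis)
  finally show "A *v column (c l) V = (S $ r l $ c l) *\<^sub>R column (r l) U"
    by (simp only: \<sigma>_def)
  have "transpose A *v column (r l) U = V *v (transpose S *v (transpose U *v column (r l) U))"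
    by (simp only: A matrix_transpose_mul transpose_transpose matrix_vector_mul_assoc
        matrix_mul_assoc)
  also have "\<dots> = \<sigma> *\<^sub>R column (c l) V"
    unfolding orthogonal_matrix_transpose_column[OF U] Sr
    by (simp only: matrix_vector_mult_scaleR matrix_vector_mult_basis)
  finally show "transpose A *v column (r l) U = (S $ r l $ c l) *\<^sub>R column (c l) V"
    by (simp only: \<sigma>_def)
qed

section \<open>Averages of a single update\<close>

text \<open>
  The probability of column \<open>j\<close> cancels the denominator of its update, leaving the product
  \<open>A v = \<Sum>\<^sub>j v\<^sub>j A\<^sub>j\<close>. A zero column has probability zero and a vanishing numerator, so the
  cancellation holds for it too.
\<close>

lemma expectation_x_update:
  fixes A :: "real^'n^'m"
  assumes "A \<noteq> 0"
  shows "measure_pmf.expectation (column_pmf A) (\<lambda>j. x_update A b j x \<bullet> v)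
       = x \<bullet> v - ((A *v x - b) \<bullet> (A *v v)) / (norm A)\<^sup>2"
proof -
  define w where "w = A *v x - b"
  have F: "(norm A)\<^sup>2 \<noteq> 0" using assms by simp
  have term_eq: "pmf (column_pmf A) j * (x_update A b j x \<bullet> v) =
      (x \<bullet> v) * ((norm (column j A))\<^sup>2 / (norm A)\<^sup>2) - (column j A \<bullet> w) * v $ j / (norm A)\<^sup>2" for j
  proof (cases "column j A = 0")
    case False
    then show ?thesis using F
      by (simp add: pmf_column_pmf[OF assms] x_update_def w_def[symmetric] inner_diff_left
          inner_axis' field_simps)
  qed (simp add: pmf_column_pmf[OF assms])
  have Av: "(\<Sum>j\<in>UNIV. (column j A \<bullet> w) * v $ j) = w \<bullet> (A *v v)"
    by (simp add: matrix_mult_sum inner_sum_right scalar_mult_eq_scaleR inner_commute mult.commute)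
  have "measure_pmf.expectation (column_pmf A) (\<lambda>j. x_update A b j x \<bullet> v)
      = (\<Sum>j\<in>UNIV. pmf (column_pmf A) j * (x_update A b j x \<bullet> v))"
    by (subst integral_measure_pmf_real[of UNIV]) (auto simp: mult.commute)
  also have "\<dots> = (x \<bullet> v) * ((\<Sum>j\<in>UNIV. (norm (column j A))\<^sup>2) / (norm A)\<^sup>2)
      - w \<bullet> (A *v v) / (norm A)\<^sup>2"
    by (simp only: term_eq sum_subtractf Av flip: sum_distrib_left sum_divide_distrib)
  also have "\<dots> = x \<bullet> v - w \<bullet> (A *v v) / (norm A)\<^sup>2"
    using F by (simp flip: norm_sq_eq_sum_columns)
  finally show ?thesis by (simp add: w_def)
qed

text \<open>
  The same cancellation for rows leaves \<open>\<langle>A (z - x), A v\<rangle>\<close>, summed coordinate by coordinate.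
\<close>

lemma expectation_z_update:
  fixes A :: "real^'n^'m"
  assumes "A \<noteq> 0"
  shows "measure_pmf.expectation (row_pmf A) (\<lambda>i. z_update A i x z \<bullet> v)
       = z \<bullet> v - ((A *v (z - x)) \<bullet> (A *v v)) / (norm A)\<^sup>2"
proof -
  have F: "(norm A)\<^sup>2 \<noteq> 0" using assms by simp
  have term_eq: "pmf (row_pmf A) i * (z_update A i x z \<bullet> v) =
      (z \<bullet> v) * ((norm (row i A))\<^sup>2 / (norm A)\<^sup>2) - (row i A \<bullet> (z - x)) * (row i A \<bullet> v) / (norm A)\<^sup>2"
    for i
  proof (cases "row i A = 0")
    case False
    define p where "p = row i A \<bullet> (z - x)"
    from False show ?thesis using F
      by (simp add: pmf_row_pmf[OF assms] z_update_def p_def[symmetric] inner_diff_left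
          field_simps)
  qed (simp add: pmf_row_pmf[OF assms])
  have Av: "(\<Sum>i\<in>UNIV. (row i A \<bullet> (z - x)) * (row i A \<bullet> v)) = (A *v (z - x)) \<bullet> (A *v v)"
    by (simp add: inner_vec_def[of "A *v (z - x)"] matrix_vector_mul_component row_def)
  have "measure_pmf.expectation (row_pmf A) (\<lambda>i. z_update A i x z \<bullet> v)
      = (\<Sum>i\<in>UNIV. pmf (row_pmf A) i * (z_update A i x z \<bullet> v))"
    by (subst integral_measure_pmf_real[of UNIV]) (auto simp: mult.commute)
  also have "\<dots> = (z \<bullet> v) * ((\<Sum>i\<in>UNIV. (norm (row i A))\<^sup>2) / (norm A)\<^sup>2)
      - (A *v (z - x)) \<bullet> (A *v v) / (norm A)\<^sup>2"
    by (simp only: term_eq sum_subtractf Av flip: sum_distrib_left sum_divide_distrib)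
  also have "\<dots> = z \<bullet> v - (A *v (z - x)) \<bullet> (A *v v) / (norm A)\<^sup>2"
    using F by (simp flip: norm_sq_eq_sum_rows)
  finally show ?thesis .
qed

lemma inner_mult_gram_eigenvector:
  fixes A :: "real^'n^'m"
  assumes "transpose A *v (A *v v) = s *\<^sub>R v"
  shows "(A *v y) \<bullet> (A *v v) = s * (y \<bullet> v)"
  using assms by (simp add: dot_lmul_matrix[symmetric] inner_commute)

lemma expectation_x_update_eigenvector:
  fixes A :: "real^'n^'m"
  assumes A: "A \<noteq> 0" and normal: "transpose A *v (A *v x\<^sub>s) = transpose A *v b"
    and eig: "transpose A *v (A *v v) = s *\<^sub>R v"
  shows "measure_pmf.expectation (column_pmf A) (\<lambda>j. (x_update A b j x - x\<^sub>s) \<bullet> v)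
       = (1 - s / (norm A)\<^sup>2) * ((x - x\<^sub>s) \<bullet> v)"
proof -
  \<comment> \<open>The residual \<open>A x\<^sub>s - b\<close> is orthogonal to the range of \<open>A\<close>, so \<open>b\<close> may be replaced by \<open>A x\<^sub>s\<close>.\<close>
  have "b \<bullet> (A *v v) = (A *v x\<^sub>s) \<bullet> (A *v v)"
    using normal by (metis dot_lmul_matrix inner_commute vector_transpose_matrix transpose_matrix_vector)
  then have "(A *v x - b) \<bullet> (A *v v) = s * ((x - x\<^sub>s) \<bullet> v)"
    by (simp add: inner_diff_left inner_mult_gram_eigenvector[OF eig] right_diff_distrib)
  then show ?thesis
    by (simp add: inner_diff_left integrable_measure_pmf_finite expectation_x_update[OF A]
        algebra_simps)
qed

lemma expectation_z_update_eigenvector: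
  fixes A :: "real^'n^'m"
  assumes A: "A \<noteq> 0" and eig: "transpose A *v (A *v v) = s *\<^sub>R v"
  shows "measure_pmf.expectation (row_pmf A) (\<lambda>i. (z_update A i x z - y) \<bullet> v)
       = (1 - s / (norm A)\<^sup>2) * ((z - y) \<bullet> v) + s / (norm A)\<^sup>2 * ((x - y) \<bullet> v)"
proof -
  have "measure_pmf.expectation (row_pmf A) (\<lambda>i. (z_update A i x z - y) \<bullet> v)
      = z \<bullet> v - s * ((z - x) \<bullet> v) / (norm A)\<^sup>2 - y \<bullet> v"
    by (simp add: inner_diff_left[of _ y] integrable_measure_pmf_finite expectation_z_update[OF A]
        inner_mult_gram_eigenvector[OF eig])
  then show ?thesis
    by (simp add: algebra_simps diff_divide_distrib)
qed

section \<open>The expected iterates\<close>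

lemma expectation_bind_pmf_finite:
  fixes h :: "'b \<Rightarrow> real"
  assumes "finite (set_pmf p)" and "\<And>a. a \<in> set_pmf p \<Longrightarrow> finite (set_pmf (f a))"
  shows "measure_pmf.expectation (bind_pmf p f) h
       = measure_pmf.expectation p (\<lambda>a. measure_pmf.expectation (f a) h)"
  using assms
  by (simp add: pmf_expectation_bind[of "set_pmf p"] integral_measure_pmf[of "set_pmf p"])

lemma finite_set_regs: "finite (set_pmf (regs A b x0 z0 k))"
  by (induction k) (auto simp: Let_def)

lemma expectation_regs_Suc:
  fixes h :: "(real^'n) \<times> (real^'n) \<Rightarrow> real"
  shows "measure_pmf.expectation (regs A b x0 z0 (Suc k)) h =
    measure_pmf.expectation (regs A b x0 z0 k) (\<lambda>(x, z).
      measure_pmf.expectation (column_pmf A) (\<lambda>j.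
        measure_pmf.expectation (row_pmf A) (\<lambda>i.
          h (x_update A b j x, z_update A i (x_update A b j x) z))))"
  by (simp add: expectation_bind_pmf_finite finite_set_regs Let_def case_prod_unfold)

text \<open>
  The two expectations obey a triangular linear recursion, solved here by induction on both at
  once. The row step of round \<open>k + 1\<close> already sees the new \<open>x\<close>, hence the forcing term carries
  the full power \<open>q ^ (k + 1)\<close>.
\<close>

lemma expectation_regs_eigenvector:
  fixes A :: "real^'n^'m"
  assumes A: "A \<noteq> 0" and normal: "transpose A *v (A *v x\<^sub>s) = transpose A *v b"
    and eig: "transpose A *v (A *v v) = s *\<^sub>R v"
  defines "q \<equiv> 1 - s / (norm A)\<^sup>2"
  shows expectation_regs_x_eigenvector:
      "measure_pmf.expectation (regs A b x0 z0 k) (\<lambda>(x, z). (x - x\<^sub>s) \<bullet> v)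
        = q ^ k * ((x0 - x\<^sub>s) \<bullet> v)" (is "?X k")
    and expectation_regs_z_eigenvector:
      "measure_pmf.expectation (regs A b x0 z0 k) (\<lambda>(x, z). (z - x\<^sub>s) \<bullet> v)
        = q ^ k * ((z0 - x\<^sub>s) \<bullet> v) + real k * (s / (norm A)\<^sup>2) * q ^ k * ((x0 - x\<^sub>s) \<bullet> v)" (is "?Z k")
proof -
  note x_step = expectation_x_update_eigenvector[OF A normal eig, folded q_def]
  note z_step = expectation_z_update_eigenvector[OF A eig, folded q_def]
  have "?X k \<and> ?Z k"
  proof (induction k)
    case (Suc k)
    have x: "?X (Suc k)"
      using Suc by (simp add: expectation_regs_Suc x_step case_prod_unfold del: regs.simps)
    have "measure_pmf.expectation (regs A b x0 z0 (Suc k)) (\<lambda>(x, z). (z - x\<^sub>s) \<bullet> v) =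
        measure_pmf.expectation (regs A b x0 z0 k)
          (\<lambda>(x, z). q * ((z - x\<^sub>s) \<bullet> v) + s / (norm A)\<^sup>2 * (q * ((x - x\<^sub>s) \<bullet> v)))"
      by (simp add: expectation_regs_Suc z_step x_step integrable_measure_pmf_finite
          case_prod_unfold del: regs.simps)
    also have "\<dots> = q * measure_pmf.expectation (regs A b x0 z0 k) (\<lambda>(x, z). (z - x\<^sub>s) \<bullet> v)
        + s / (norm A)\<^sup>2 * (q *
            measure_pmf.expectation (regs A b x0 z0 k) (\<lambda>(x, z). (x - x\<^sub>s) \<bullet> v))"
      by (simp add: case_prod_unfold integrable_measure_pmf_finite finite_set_regs)
    finally have "?Z (Suc k)"
      unfolding Suc.IH[THEN conjunct1] Suc.IH[THEN conjunct2]
      by (simp add: ring_distribs add_divide_distrib mult_ac)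
    with x show ?case ..
  qed simp
  then show "?X k" "?Z k" by blast+
qed

theorem theorem8:
  fixes A :: "real^'n^'m" and b :: "real^'m" and x\<^sub>0 z\<^sub>0 x\<^sub>s :: "real^'n"
    and U :: "real^'m^'m" and S :: "real^'n^'m" and V :: "real^'n^'n"
    and r :: "nat \<Rightarrow> 'm" and c :: "nat \<Rightarrow> 'n" and k l :: nat
  assumes "A \<noteq> 0"
    and "x\<^sub>s = pseudoinverse A *v b"
    and "is_svd r c A U S V"
    and "z\<^sub>0 \<in> span (columns (transpose A))"
    and "l \<in> {1..min CARD('m) CARD('n)}"
  shows "measure_pmf.expectation (regs A b x\<^sub>0 z\<^sub>0 k)
           (\<lambda>(x, z). (A *v z - A *v x\<^sub>s) \<bullet> column (r l) U)
       = (1 - (S $ r l $ c l)\<^sup>2 / (norm A)\<^sup>2) ^ k * ((A *v z\<^sub>0 - A *v x\<^sub>s) \<bullet> column (r l) U)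
       + real k / (norm A)\<^sup>2 * (1 - (S $ r l $ c l)\<^sup>2 / (norm A)\<^sup>2) ^ k
           * (((A ** transpose A) *v (A *v x\<^sub>0 - A *v x\<^sub>s)) \<bullet> column (r l) U)"
proof -
  define u where "u = column (r l) U"
  define v where "v = column (c l) V"
  define \<sigma> where "\<sigma> = S $ r l $ c l"
  have Av: "A *v v = \<sigma> *\<^sub>R u" and Au: "transpose A *v u = \<sigma> *\<^sub>R v"
    using is_svd_singular_vectors[OF assms(3,5)] by (simp_all add: u_def v_def \<sigma>_def)
  have eig: "transpose A *v (A *v v) = \<sigma>\<^sup>2 *\<^sub>R v"
    by (simp only: Av Au matrix_vector_mult_scaleR scaleR_scaleR power2_eq_square)
  have normal: "transpose A *v (A *v x\<^sub>s) = transpose A *v b"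
    unfolding assms(2)
    by (rule is_pseudoinverse_normal_equations[OF is_pseudoinverse_pseudoinverse_if_svd[OF assms(3)]])
  have along_u: "(A *v y) \<bullet> u = \<sigma> * (y \<bullet> v)" for y
    by (metis Au dot_lmul_matrix inner_commute inner_scaleR_left transpose_matrix_vector)
  have err: "(A *v y - A *v x\<^sub>s) \<bullet> u = \<sigma> * ((y - x\<^sub>s) \<bullet> v)" for y
    by (simp add: along_u flip: matrix_vector_mult_diff_distrib)
  have AAT: "((A ** transpose A) *v (A *v x\<^sub>0 - A *v x\<^sub>s)) \<bullet> u = \<sigma>\<^sup>2 * (\<sigma> * ((x\<^sub>0 - x\<^sub>s) \<bullet> v))"
  proof -
    have "((A ** transpose A) *v (A *v x\<^sub>0 - A *v x\<^sub>s)) \<bullet> u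
        = \<sigma> * ((transpose A *v (A *v x\<^sub>0 - A *v x\<^sub>s)) \<bullet> v)"
      by (simp add: along_u flip: matrix_vector_mul_assoc)
    also have "(transpose A *v (A *v x\<^sub>0 - A *v x\<^sub>s)) \<bullet> v = (A *v (x\<^sub>0 - x\<^sub>s)) \<bullet> (A *v v)"
      by (simp add: dot_lmul_matrix flip: matrix_vector_mult_diff_distrib)
    also have "\<dots> = \<sigma>\<^sup>2 * ((x\<^sub>0 - x\<^sub>s) \<bullet> v)"
      by (rule inner_mult_gram_eigenvector[OF eig])
    finally show ?thesis by (simp add: mult_ac)
  qed
  have "measure_pmf.expectation (regs A b x\<^sub>0 z\<^sub>0 k) (\<lambda>(x, z). (A *v z - A *v x\<^sub>s) \<bullet> u)
      = \<sigma> * measure_pmf.expectation (regs A b x\<^sub>0 z\<^sub>0 k) (\<lambda>(x, z). (z - x\<^sub>s) \<bullet> v)"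
    by (simp add: err case_prod_unfold)
  then show ?thesis
    unfolding u_def[symmetric] \<sigma>_def[symmetric] AAT err
      expectation_regs_z_eigenvector[OF assms(1) normal eig]
    by (simp add: algebra_simps)
qed

end
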